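(* Let $A=[a_1\ \cdots\ a_n]\in\mathbb{R}^{d\times n}$ with $\|a_i\|=1$ for $i=1,\dots,n$, and let $w_0,w_1,w_2,\dots$ be a sequence of Normalized Perceptron iterates for $A$. Then the Normalized Perceptron gives an $\epsilon$-approximation of the value of the positive margin in $4/\epsilon^2$ steps: for every $\epsilon>0$ such that $4/\epsilon^2$ is a positive integer, $$\|w_{4/\epsilon^2}\|-\epsilon\le\rho_A^+\le\|w_{4/\epsilon^2}\|.$$
   Context: $\mathrm{lin}(A)=\{A\alpha:\alpha\in\mathbb{R}^n\}$ is the linear span of the columns of $A$; $\triangle=\{p\in\mathbb{R}^n: p\ge\mathbf{0},\ \|p\|_1=1\}$ is the probability simplex; $\|\cdot\|$ is the Euclidean norm. The affine-margin is $\rho_A:=\sup\{\inf_{p\in\triangle}w^TAp : w\in\mathrm{lin}(A),\ \|w\|=1\}$ and the positive margin is $\rho_A^+:=\max\{0,\rho_A\}$. Normalized Perceptron (NP): start with $w_0=a_{i_0}$ for an arbitrary index $i_0$; for $t=1,2,\dots$ choose an index $i_t\in\arg\min_{i}\{w_{t-1}^Ta_i\}$ (ties broken arbitrarily) and set $w_t=(1-\tfrac1t)w_{t-1}+\tfrac1t a_{i_t}$. *)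

theory Defs
  imports "HOL-Analysis.Analysis"
begin

definition lin :: "real^'n^'d \<Rightarrow> (real^'d) set" where
  "lin A = {A *v \<alpha> | \<alpha>. True}"

definition prob_simplex :: "(real^'n) set" where
  "prob_simplex = {p. (\<forall>i. 0 \<le> p $ i) \<and> (\<Sum>i\<in>UNIV. \<bar>p $ i\<bar>) = 1}"

(* The infimum is over a nonempty compact set.  The set under the supremum is bounded above, and
   it is nonempty iff A is not the zero matrix, so both are the true extrema whenever A \<noteq> 0. *)
definition affine_margin :: "real^'n^'d \<Rightarrow> real" where
  "affine_margin A =
     (SUP w\<in>{w. w \<in> lin A \<and> norm w = 1}. INF p\<in>prob_simplex. w \<bullet> (A *v p))"

definition positive_margin :: "real^'n^'d \<Rightarrow> real" where
  "positive_margin A = max 0 (affine_margin A)"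

(* The existentially quantified index sequence idx covers the arbitrary choice of the starting
   column and every possible tie-breaking. *)
definition np_iterates :: "real^'n^'d \<Rightarrow> (nat \<Rightarrow> real^'d) \<Rightarrow> bool" where
  "np_iterates A w \<longleftrightarrow>
     (\<exists>idx :: nat \<Rightarrow> 'n.
        w 0 = column (idx 0) A \<and>
        (\<forall>t\<ge>1. is_arg_min (\<lambda>i. w (t - 1) \<bullet> column i A) (\<lambda>i. True) (idx t) \<and>
               w t = (1 - 1 / real t) *\<^sub>R w (t - 1) + (1 / real t) *\<^sub>R column (idx t) A))"

end

theory Submission
  imports Defs
begin

text \<open>
  Every iterate is \<open>A p\<close> for some \<open>p\<close> in the simplex, so
  \<open>inf\<^sub>p v\<^sup>T A p \<le> v\<^sup>T w\<^sub>N \<le> \<parallel>w\<^sub>N\<parallel>\<close> for every unit vector \<open>v\<close>, which gives the upper bound.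
  For the lower bound put \<open>u\<^sub>t = t \<parallel>w\<^sub>t\<parallel>\<close>. Normalising \<open>w\<^sub>t\<close> shows that
  \<open>min\<^sub>i w\<^sub>t\<^sup>T a\<^sub>i \<le> \<rho>\<^sup>+ \<parallel>w\<^sub>t\<parallel>\<close>, and expanding the square of the update gives the Perceptron recursion
  \<open>u\<^sub>t\<^sup>2 \<le> u\<^sub>t\<^sub>-\<^sub>1\<^sup>2 + 2 \<rho>\<^sup>+ u\<^sub>t\<^sub>-\<^sub>1 + 1\<close>. By induction \<open>u\<^sub>t \<le> \<rho>\<^sup>+ t + \<surd>t\<close>, hence
  \<open>\<parallel>w\<^sub>N\<parallel> \<le> \<rho>\<^sup>+ + 1 / \<surd>N = \<rho>\<^sup>+ + \<epsilon> / 2\<close>, twice as good as required.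
\<close>

lemma prob_simplex_iff: "p \<in> prob_simplex \<longleftrightarrow> (\<forall>i. 0 \<le> p $ i) \<and> (\<Sum>i\<in>UNIV. p $ i) = 1"
proof (cases "\<forall>i. 0 \<le> p $ i")
  case True
  then have "(\<Sum>i\<in>UNIV. \<bar>p $ i\<bar>) = (\<Sum>i\<in>UNIV. p $ i)"
    by (intro sum.cong) auto
  with True show ?thesis
    by (simp only: prob_simplex_def mem_Collect_eq)
qed (auto simp: prob_simplex_def)

lemma convex_prob_simplex: "convex (prob_simplex :: (real^'n) set)"
  by (rule convexI) (simp add: prob_simplex_iff sum.distrib flip: sum_distrib_left)

lemma axis_in_prob_simplex: "axis i 1 \<in> (prob_simplex :: (real^'n) set)"
  by (simp add: prob_simplex_iff axis_def)

text \<open>\<open>v \<bullet> (A *v p)\<close> is the average of the values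
  \<open>v \<bullet> column i A\<close> with weights \<open>p $ i\<close>.\<close>

lemma inner_mult_simplex_ge:
  fixes A :: "real^'n^'d"
  assumes "p \<in> prob_simplex" and "\<And>i. m \<le> v \<bullet> column i A"
  shows "m \<le> v \<bullet> (A *v p)"
proof -
  have p: "0 \<le> p $ i" and "(\<Sum>i\<in>UNIV. p $ i) = 1" for i
    using assms(1) by (simp_all add: prob_simplex_iff)
  then have "m = (\<Sum>i\<in>UNIV. p $ i * m)"
    by (simp flip: sum_distrib_right)
  also have "\<dots> \<le> (\<Sum>i\<in>UNIV. p $ i * (v \<bullet> column i A))"
    by (intro sum_mono mult_left_mono assms(2) p)
  also have "\<dots> = v \<bullet> (A *v p)"
    by (simp add: matrix_mult_sum inner_sum_right scalar_mult_eq_scaleR)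
  finally show ?thesis .
qed

lemma INF_simplex_ge:
  fixes A :: "real^'n^'d"
  assumes "\<And>i. m \<le> v \<bullet> column i A"
  shows "m \<le> (INF p\<in>prob_simplex. v \<bullet> (A *v p))"
  using assms axis_in_prob_simplex by (intro cINF_greatest inner_mult_simplex_ge) auto

lemma INF_simplex_le:
  fixes A :: "real^'n^'d"
  assumes "p \<in> prob_simplex"
  shows "(INF p\<in>prob_simplex. v \<bullet> (A *v p)) \<le> v \<bullet> (A *v p)"
proof (rule cINF_lower[OF _ assms])
  \<comment> \<open>The infimum over reals needs a lower bound; the smallest of the finitely many
    column values is one.\<close>
  have "Min (range (\<lambda>i. v \<bullet> column i A)) \<le> v \<bullet> (A *v q)" if "q \<in> prob_simplex" for q
    using that by (rule inner_mult_simplex_ge) simp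
  then show "bdd_below ((\<lambda>p. v \<bullet> (A *v p)) ` prob_simplex)"
    by (rule bdd_belowI2)
qed

lemma INF_simplex_le_norm:
  fixes A :: "real^'n^'d"
  assumes "p \<in> prob_simplex" and "norm v = 1"
  shows "(INF p\<in>prob_simplex. v \<bullet> (A *v p)) \<le> norm (A *v p)"
  using INF_simplex_le[OF assms(1)] norm_cauchy_schwarz[of v "A *v p"] assms(2)
  by (metis mult_1 order_trans)

lemma column_in_lin: "column i A \<in> lin A"
  by (auto simp: lin_def simp flip: matrix_vector_mul_component matrix_vector_mult_basis)

text \<open>Weak duality: Cauchy-Schwarz bounds the infimum for each unit \<open>v\<close>. The unit
  column makes the set under the supremum nonempty.\<close>

lemma affine_margin_le_norm:
  fixes A :: "real^'n^'d"
  assumes "norm (column i A) = 1" and "p \<in> prob_simplex"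
  shows "affine_margin A \<le> norm (A *v p)"
  unfolding affine_margin_def
  using assms column_in_lin[of i A] by (intro cSUP_least INF_simplex_le_norm) auto

lemma le_affine_margin:
  fixes A :: "real^'n^'d"
  assumes "v \<in> lin A" and "norm v = 1" and "\<And>i. m \<le> v \<bullet> column i A"
  shows "m \<le> affine_margin A"
proof -
  have "bdd_above ((\<lambda>v. INF p\<in>prob_simplex. v \<bullet> (A *v p)) ` {v \<in> lin A. norm v = 1})"
    \<comment> \<open>Any point of the simplex gives an upper bound; an arbitrary vertex is
      taken.\<close>
    by (rule bdd_aboveI2[where M = "norm (A *v axis undefined 1)"])
       (auto intro: INF_simplex_le_norm axis_in_prob_simplex)
  then have "(INF p\<in>prob_simplex. v \<bullet> (A *v p)) \<le> affine_margin A"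
    unfolding affine_margin_def using assms(1,2) by (intro cSUP_upper) auto
  with INF_simplex_ge[OF assms(3)] show ?thesis
    by (rule order_trans)
qed

text \<open>By homogeneity it suffices to rescale \<open>v\<close> to a unit vector, which competes
  in the supremum; for \<open>v = 0\<close> the hypothesis already says
  \<open>m \<le> 0\<close>.\<close>

lemma min_inner_le_positive_margin:
  fixes A :: "real^'n^'d"
  assumes "v \<in> lin A" and "\<And>i. m \<le> v \<bullet> column i A"
  shows "m \<le> positive_margin A * norm v"
proof (cases "v = 0")
  case True
  then show ?thesis using assms(2) by simp
next
  case False
  obtain \<alpha> where "v = A *v \<alpha>"
    using assms(1) by (auto simp: lin_def)
  then have "v /\<^sub>R norm v = A *v (\<alpha> /\<^sub>R norm v)"
    by (simp add: scaleR_matrix_vector_assoc matrix_vector_mult_scaleR)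
  then have "v /\<^sub>R norm v \<in> lin A"
    unfolding lin_def by blast
  moreover have "m / norm v \<le> (v /\<^sub>R norm v) \<bullet> column i A" for i
    using assms(2)[of i] by (simp add: divide_inverse_commute mult_left_mono)
  ultimately have "m / norm v \<le> affine_margin A"
    using False by (intro le_affine_margin) auto
  then have "m / norm v \<le> positive_margin A"
    by (simp add: positive_margin_def)
  then show ?thesis
    using False by (simp add: pos_divide_le_eq)
qed

text \<open>The image of the simplex is convex and contains the columns, and each update is a convex
  combination of the last iterate and a column.\<close>

lemma np_iterate_in_hull:
  fixes A :: "real^'n^'d"
  assumes "np_iterates A w"
  shows "w t \<in> (*v) A ` prob_simplex"
proof -
  obtain idx where w0: "w 0 = column (idx 0) A"
    and step: "\<And>t. t \<ge> 1 \<Longrightarrow>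
      w t = (1 - 1 / real t) *\<^sub>R w (t - 1) + (1 / real t) *\<^sub>R column (idx t) A"
    using assms unfolding np_iterates_def by blast
  have col: "column i A \<in> (*v) A ` prob_simplex" for i
    using axis_in_prob_simplex by (metis image_eqI matrix_vector_mult_basis)
  have conv: "convex ((*v) A ` prob_simplex)"
    by (intro convex_linear_image convex_prob_simplex) simp
  show ?thesis
  proof (induction t)
    case 0
    then show ?case using w0 col by simp
  next
    case (Suc t)
    show ?case
      using step[of "Suc t"] convexD[OF conv Suc.IH col[of "idx (Suc t)"],
          of "1 - 1 / real (Suc t)" "1 / real (Suc t)"] by simp
  qed
qed

text \<open>The factor \<open>t\<close> turns the update into the plain Perceptron step of adding a
  column. It also makes the base case trivial: the first step gives \<open>w 0\<close> weight
  0.\<close>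

lemma np_norm_bound:
  fixes A :: "real^'n^'d"
  assumes unit: "\<And>i. norm (column i A) = 1" and np: "np_iterates A w"
  shows "real t * norm (w t) \<le> positive_margin A * real t + sqrt (real t)"
proof (induction t)
  case 0
  then show ?case by simp
next
  case (Suc t)
  define \<rho> where "\<rho> = positive_margin A"
  define u where "u = real t * norm (w t)"
  have \<rho>: "0 \<le> \<rho>"
    by (simp add: \<rho>_def positive_margin_def)
  have u: "0 \<le> u"
    by (simp add: u_def)
  obtain i where minimal: "\<And>j. w t \<bullet> column i A \<le> w t \<bullet> column j A"
    and step: "w (Suc t) = (1 - 1 / real (Suc t)) *\<^sub>R w t + (1 / real (Suc t)) *\<^sub>R column i A"
    using np unfolding np_iterates_def is_arg_min_linorder
    by (metis diff_Suc_1 le_add1 plus_1_eq_Suc)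
  have "real (Suc t) *\<^sub>R w (Suc t) = real t *\<^sub>R w t + column i A"
    unfolding step by (simp add: scaleR_add_right field_simps del: of_nat_Suc) (simp add: algebra_simps)
  then have "(real (Suc t) * norm (w (Suc t)))\<^sup>2 = (norm (real t *\<^sub>R w t + column i A))\<^sup>2"
    by (metis norm_scaleR abs_of_nat)
  also have "\<dots> = u\<^sup>2 + 2 * (real t * (w t \<bullet> column i A)) + 1"
    using unit[of i] by (simp add: power2_norm_eq_inner inner_add inner_commute u_def
        power_mult_distrib norm_eq_1) (simp add: power2_eq_square)
  also have "\<dots> \<le> u\<^sup>2 + 2 * (\<rho> * u) + 1"
  proof -
    have "w t \<in> lin A"
      using np_iterate_in_hull[OF np, of t] by (auto simp: lin_def)
    then have "w t \<bullet> column i A \<le> \<rho> * norm (w t)"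
      unfolding \<rho>_def using minimal by (rule min_inner_le_positive_margin)
    then have "real t * (w t \<bullet> column i A) \<le> real t * (\<rho> * norm (w t))"
      by (rule mult_left_mono) simp
    then show ?thesis
      by (simp add: u_def mult_ac)
  qed
  \<comment> \<open>Completing the square lets the induction hypothesis bound
    \<open>u + \<rho>\<close>.\<close>
  also have "\<dots> = (u + \<rho>)\<^sup>2 - \<rho>\<^sup>2 + 1"
    by (simp add: power2_sum)
  also have "\<dots> \<le> (\<rho> * real (Suc t) + sqrt (real t))\<^sup>2 + 1"
  proof -
    have "u + \<rho> \<le> \<rho> * real (Suc t) + sqrt (real t)"
      using Suc.IH by (simp add: u_def \<rho>_def algebra_simps)
    then have "(u + \<rho>)\<^sup>2 \<le> (\<rho> * real (Suc t) + sqrt (real t))\<^sup>2"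
      using u \<rho> by (intro power_mono) auto
    then show ?thesis
      using zero_le_power2[of \<rho>] by linarith
  qed
  \<comment> \<open>After expansion the summand 1 turns \<open>t\<close> into \<open>Suc t\<close>,
    so only the cross terms need comparing.\<close>
  also have "\<dots> \<le> (\<rho> * real (Suc t) + sqrt (real (Suc t)))\<^sup>2"
  proof -
    have "\<rho> * real (Suc t) * sqrt (real t) \<le> \<rho> * real (Suc t) * sqrt (real (Suc t))"
      using \<rho> by (intro mult_left_mono) auto
    then show ?thesis
      by (simp add: power2_sum del: of_nat_Suc)
  qed
  finally show ?case
    unfolding \<rho>_def[symmetric] by (rule power2_le_imp_le) (use \<rho> in simp)
qed

theorem proposition6:
  fixes A :: "real^'n^'d"
    and w :: "nat \<Rightarrow> real^'d"
    and \<epsilon> :: real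
    and N :: nat
  assumes unit_columns: "\<And>i. norm (column i A) = 1"
    and iterates: "np_iterates A w"
    and eps_pos: "\<epsilon> > 0"
    and N_pos: "N > 0"
    and N_eq: "real N = 4 / \<epsilon>\<^sup>2"
  shows "norm (w N) - \<epsilon> \<le> positive_margin A \<and> positive_margin A \<le> norm (w N)"
proof
  have "sqrt (real N) = 2 / \<epsilon>"
    using eps_pos by (simp add: N_eq real_sqrt_divide)
  also have "\<dots> = real N * (\<epsilon> / 2)"
    using eps_pos by (simp add: N_eq power2_eq_square)
  finally have "real N * norm (w N) \<le> real N * (positive_margin A + \<epsilon> / 2)"
    using np_norm_bound[OF unit_columns iterates, of N] by (simp add: algebra_simps)
  then have "norm (w N) \<le> positive_margin A + \<epsilon> / 2"
    using N_pos by simp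
  then show "norm (w N) - \<epsilon> \<le> positive_margin A"
    using eps_pos by linarith
  show "positive_margin A \<le> norm (w N)"
    \<comment> \<open>Nonnegativity of the norm covers the 0 in the maximum.\<close>
    using np_iterate_in_hull[OF iterates, of N] affine_margin_le_norm[OF unit_columns]
    by (auto simp: positive_margin_def)
qed

end
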